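(* For every integer $n\ge 2$, $$s(\mathbb{Z}_n, 3) = \begin{cases} \lfloor n/4 \rfloor & \text{if $n$ is even},\\ \left(1+\frac{1}{p}\right) \frac{n}{6} & \text{if $n$ is odd and has a prime divisor congruent to $5 \pmod 6$, where $p$ is the smallest such prime divisor},\\ \lfloor n/6 \rfloor & \text{otherwise}. \end{cases}$$
   Context: $\mathbb{Z}_n$ is the cyclic group of order $n$. A subset $A=\{a_1,\dots,a_m\}$ (with $m\ge1$) of an abelian group $G$ is called $t$-independent if whenever $\lambda_1a_1+\cdots+\lambda_ma_m=0$ for integers $\lambda_i$ with $\sum|\lambda_i|\le t$, we have all $\lambda_i=0$. $s(G,t)$ denotes the largest size of a $t$-independent subset of $G$ ($0$ if there is none). *)

theory Defs
  imports
    Complex_Main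
    "HOL-Algebra.FiniteProduct"
    "HOL-Algebra.Elementary_Groups"
    "HOL-Number_Theory.Cong"
    "HOL-Computational_Algebra.Primes"
begin

(* Abelian groups are commutative groups of HOL-Algebra, written multiplicatively there: the
   integer combination l_1 a_1 + ... + l_m a_m is the finite product of the powers a [^] l a,
   and 0 is the neutral element. A coefficient family is a function on the carrier type of
   which only the values on A matter. *)
definition t_independent :: "('a, 'b) monoid_scheme \<Rightarrow> nat \<Rightarrow> 'a set \<Rightarrow> bool" where
  "t_independent G t A \<longleftrightarrow>
     finite A \<and> A \<noteq> {} \<and> A \<subseteq> carrier G \<and>
     (\<forall>l :: 'a \<Rightarrow> int.
        finprod G (\<lambda>a. a [^]\<^bsub>G\<^esub> l a) A = \<one>\<^bsub>G\<^esub> \<and> (\<Sum>a\<in>A. \<bar>l a\<bar>) \<le> int t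
        \<longrightarrow> (\<forall>a\<in>A. l a = 0))"

(* Meaningful when the cardinalities are bounded, in particular for finite G. *)
definition max_independent_size :: "('a, 'b) monoid_scheme \<Rightarrow> nat \<Rightarrow> nat" where
  "max_independent_size G t =
     (if \<exists>A. t_independent G t A then Max {card A |A. t_independent G t A} else 0)"

end

theory Submission
  imports Defs "HOL-Algebra.Multiplicative_Group"
begin

text \<open>
  If \<open>A\<close> is 3-independent then \<open>S = A \<union> -A\<close> is a symmetric sum-free set of size \<open>2|A|\<close>, which gives
  the bound for even \<open>n\<close> at once. For odd \<open>n\<close> Kneser's theorem is replaced by Hamidoune's isoperimetric
  method: since \<open>S\<close> is symmetric, the minimum of \<open>|X + S| - |X|\<close> over the nonempty \<open>X\<close> with
  \<open>X + S \<noteq> G\<close> is attained at a subgroup \<open>H\<close>. Taking \<open>X = S\<close> yields \<open>2|S| + |H + S| \<le> n + |H|\<close>.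
  If \<open>S\<close> meets \<open>H\<close>, then a translate of \<open>S\<close> is disjoint from \<open>S\<close> within \<open>H + S\<close>, so \<open>3|S| \<le> n\<close>.
  Otherwise \<open>H + S\<close> is symmetric without 0, hence consists of an even number of cosets of \<open>H\<close>, and
  with \<open>m = n / |H|\<close> either \<open>3|S| \<le> n\<close>, or \<open>m \<equiv> 5 (mod 6)\<close> and \<open>3|S| \<le> (m + 1)|H|\<close>.
  Extremal sets are the odd numbers below \<open>n/2\<close> and the numbers whose residue modulo \<open>m\<close> lies strictly
  between \<open>m/3\<close> and \<open>m/2\<close>, with \<open>m = p\<close> or \<open>m = n\<close>.
\<close>

section \<open>Parity and counting arithmetic\<close>

lemma even_card_fixpoint_free_involution:
  assumes "finite A" "\<And>x. x \<in> A \<Longrightarrow> f x \<in> A" "\<And>x. x \<in> A \<Longrightarrow> f (f x) = x" "\<And>x. x \<in> A \<Longrightarrow> f x \<noteq> x"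
  shows "even (card A)"
  using assms
proof (induction "card A" arbitrary: A rule: less_induct)
  case less
  show ?case
  proof (cases "A = {}")
    case False
    then obtain x where x: "x \<in> A" by blast
    define B where "B = A - {x, f x}"
    have "A = insert x (insert (f x) B)" "finite B" "x \<notin> insert (f x) B" "f x \<notin> B"
      using x less.prems(1,2) less.prems(4)[OF x] by (auto simp: B_def)
    then have c: "card A = card B + 2" by simp
    have "even (card B)"
    proof (rule less.hyps)
      show "f y \<in> B" if "y \<in> B" for y using that x less.prems by (auto simp: B_def) metis+
    qed (use c less.prems in \<open>auto simp: B_def\<close>)
    then show ?thesis using c by simp
  qed simp
qed

text \<open>Here s = |S|, h = |H|, m is the index of H and k the number of cosets of H in H + S.
  With m = 2a + 1 and k = 2b the hypotheses say s \<le> 2bh and s \<le> (a + 1 - b)h. One of these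
  gives 3s \<le> mh unless 3b = a + 1; in that exceptional case m = 6b - 1 and 3s \<le> 6bh = (m +
  1)h.\<close>

lemma card_bound_arith:
  fixes s m h k :: nat
  assumes "s \<le> k * h" "2 * s + k * h \<le> m * h + h" "even k" "odd m"
  shows "3 * s \<le> m * h \<or> m mod 6 = 5 \<and> 3 * s \<le> (m + 1) * h"
proof -
  obtain a where a: "m = 2 * a + 1" using \<open>odd m\<close> by (rule oddE)
  obtain b where b: "k = 2 * b" using \<open>even k\<close> by (rule evenE)
  have "2 * s \<le> 2 * ((a + 1 - b) * h)"
    using assms(2) by (simp add: a b algebra_simps diff_mult_distrib)
  then have le: "3 * s \<le> (6 * b) * h" "3 * s \<le> (3 * (a + 1 - b)) * h"
    using assms(1) by (simp_all add: b)
  have bound: "3 * s \<le> M * h" if "6 * b \<le> M \<or> 3 * (a + 1 - b) \<le> M" for M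
    using that le mult_le_mono1[of _ M h] by (meson le_trans)
  have "6 * b \<le> 2 * a + 1 \<or> 3 * (a + 1 - b) \<le> 2 * a + 1 \<or>
      a mod 3 = 2 \<and> (6 * b \<le> 2 * a + 2 \<or> 3 * (a + 1 - b) \<le> 2 * a + 2)"
    by presburger
  moreover have "m mod 6 = 5" if "a mod 3 = 2" using that unfolding a by presburger
  ultimately have "(6 * b \<le> m \<or> 3 * (a + 1 - b) \<le> m) \<or>
      m mod 6 = 5 \<and> (6 * b \<le> m + 1 \<or> 3 * (a + 1 - b) \<le> m + 1)"
    by (simp add: a) blast
  then show ?thesis using bound by blast
qed

section \<open>Hamidoune's isoperimetric method in finite abelian groups\<close>

context comm_group
begin

lemma set_multE:
  assumes "z \<in> X <#> S" obtains x s where "x \<in> X" "s \<in> S" "z = x \<otimes> s"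
  using assms by (auto simp: set_mult_def)

lemma set_multI: "x \<in> X \<Longrightarrow> s \<in> S \<Longrightarrow> x \<otimes> s \<in> X <#> S"
  by (auto simp: set_mult_def)

lemma card_l_coset:
  assumes "a \<in> carrier G" "X \<subseteq> carrier G" shows "card (a <# X) = card X"
proof -
  have "a <# X = (\<otimes>) a ` X" by (auto simp: l_coset_def)
  moreover have "inj_on ((\<otimes>) a) X"
    using assms inj_on_cmult inj_on_subset by blast
  ultimately show ?thesis by (simp add: card_image)
qed

text \<open>Call the smallest minimisers of |XS| - |X| atoms. Distinct atoms are disjoint and
  translates of atoms are atoms, so the atom containing the neutral element equals its translates by
  inverses of its own elements, which makes it a subgroup.\<close>

theorem isoperimetric_subgroup:
  assumes fin: "finite (carrier G)"
    and S: "S \<subseteq> carrier G" "S \<noteq> carrier G" and sym: "\<And>x. x \<in> S \<Longrightarrow> inv x \<in> S"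
  obtains H where "subgroup H G" "H <#> S \<noteq> carrier G"
    "\<And>X. \<lbrakk>X \<subseteq> carrier G; X \<noteq> {}; X <#> S \<noteq> carrier G\<rbrakk>
        \<Longrightarrow> card X + card (H <#> S) \<le> card (X <#> S) + card H"
proof -
  define F where "F = {X. X \<subseteq> carrier G \<and> X \<noteq> {} \<and> X <#> S \<noteq> carrier G}"
  \<comment> \<open>The values are integers because the difference can be negative, for instance for
    empty \<open>S\<close>.\<close>
  define d where "d X = int (card (X <#> S)) - int (card X)" for X
  have finF: "finite F" using fin by (auto simp: F_def intro: finite_subset[of _ "Pow (carrier G)"])
  have "{\<one>} <#> S = S"
    using S(1) by (force simp: set_mult_def)
  then have "{\<one>} \<in> F" using S by (auto simp: F_def)
  then obtain X0 where X0: "X0 \<in> F" and X0min: "\<And>Y. Y \<in> F \<Longrightarrow> d X0 \<le> d Y"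
    using arg_min_if_finite[of F d] finF by (metis empty_iff not_less)
  define \<kappa> where "\<kappa> = d X0"
  define F' where "F' = {X \<in> F. d X = \<kappa>}"
  have "X0 \<in> F'" "finite F'" using X0 finF by (auto simp: F'_def \<kappa>_def)
  then obtain X1 where X1: "X1 \<in> F'" and X1min: "\<And>Y. Y \<in> F' \<Longrightarrow> card X1 \<le> card Y"
    using arg_min_if_finite[of F' card] by (metis empty_iff not_less)
  define a where "a = card X1"
  have fs: "finite X" if "X \<subseteq> carrier G" for X using fin that finite_subset by blast
  have mS: "X <#> S \<subseteq> carrier G" if "X \<subseteq> carrier G" for X using that S setmult_subset_G by blast
  \<comment> \<open>Translating \<open>X\<close> translates \<open>X <#> S\<close>, so admissibility
    and both cardinalities are preserved.\<close>
  have translate: "g <# X \<in> F' \<and> card (g <# X) = card X" if g: "g \<in> carrier G" and X: "X \<in> F'" for g X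
  proof -
    have Xc: "X \<subseteq> carrier G" "X \<noteq> {}" "X <#> S \<noteq> carrier G" "d X = \<kappa>" using X by (auto simp: F'_def F_def)
    have eq: "(g <# X) <#> S = g <# (X <#> S)"
      using Xc g S by (simp add: l_coset_eq_set_mult set_mult_assoc)
    have c: "card (g <# X) = card X" "card (g <# (X <#> S)) = card (X <#> S)"
      using card_l_coset g Xc mS by auto
    moreover have "g <# X \<subseteq> carrier G" "g <# X \<noteq> {}" using Xc g by (auto simp: l_coset_def)
    moreover have "card (X <#> S) < card (carrier G)"
      using Xc mS fin by (meson psubsetI psubset_card_mono)
    ultimately show ?thesis using Xc by (auto simp: F'_def F_def d_def eq)
  qed
  \<comment> \<open>By symmetry the complement of \<open>X1 <#> S\<close> is again a minimiser, so it is at least as large as \<open>X1\<close>.\<close>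
  have big: "2 * int a + \<kappa> \<le> int (card (carrier G))"
  proof -
    define Y where "Y = carrier G - (X1 <#> S)"
    have Xc: "X1 \<subseteq> carrier G" "X1 \<noteq> {}" "X1 <#> S \<noteq> carrier G" "d X1 = \<kappa>" using X1 by (auto simp: F'_def F_def)
    have Yc: "Y \<subseteq> carrier G" "Y \<noteq> {}" using Xc mS by (auto simp: Y_def)
    have YS: "Y <#> S \<subseteq> carrier G - X1"
    proof
      fix z assume "z \<in> Y <#> S"
      then obtain y s where ys: "y \<in> Y" "s \<in> S" "z = y \<otimes> s" by (rule set_multE)
      have c: "y \<in> carrier G" "s \<in> carrier G" using ys Yc S by auto
      have "z \<notin> X1"
      proof
        assume "z \<in> X1"
        then have "z \<otimes> inv s \<in> X1 <#> S" using sym ys by (intro set_multI) auto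
        moreover have "z \<otimes> inv s = y" using ys c by (simp add: m_assoc)
        ultimately show False using ys by (auto simp: Y_def)
      qed
      then show "z \<in> carrier G - X1" using ys c by auto
    qed
    have cYS: "card (Y <#> S) \<le> card (carrier G) - card X1"
      using card_mono[OF _ YS] fin Xc fs by (simp add: card_Diff_subset)
    have cY: "card Y = card (carrier G) - card (X1 <#> S)"
      using Xc fs mS by (simp add: Y_def card_Diff_subset)
    have le: "card (X1 <#> S) \<le> card (carrier G)" "card X1 \<le> card (carrier G)"
      using Xc mS fin by (auto intro!: card_mono)
    have YF: "Y \<in> F" using Yc YS Xc by (auto simp: F_def)
    have "d Y \<le> \<kappa>" using cYS cY le Xc(4) by (simp add: d_def)
    with X0min[OF YF] have "Y \<in> F'" using YF by (simp add: F'_def \<kappa>_def)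
    then have "a \<le> card Y" using X1min a_def by blast
    then show ?thesis using cY le Xc(4) a_def by (simp add: d_def)
  qed
  \<comment> \<open>Minimisers of least size are disjoint or equal, by submodularity of \<open>X \<mapsto> card (X <#> S)\<close>.\<close>
  have disj: "X = Y" if X: "X \<in> F'" "card X = a" and Y: "Y \<in> F'" "card Y = a" and ne: "X \<inter> Y \<noteq> {}" for X Y
  proof (rule ccontr)
    assume "X \<noteq> Y"
    have Xc: "X \<subseteq> carrier G" "X \<noteq> {}" "X <#> S \<noteq> carrier G" "d X = \<kappa>" using X by (auto simp: F'_def F_def)
    have Yc: "Y \<subseteq> carrier G" "Y \<noteq> {}" "Y <#> S \<noteq> carrier G" "d Y = \<kappa>" using Y by (auto simp: F'_def F_def)
    have "X \<inter> Y \<noteq> X" using \<open>X \<noteq> Y\<close> X Y fs Yc(1) by (metis card_subset_eq inf.orderI inf_commute)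
    then have lt: "card (X \<inter> Y) < a" using X(2) fs[OF Xc(1)] by (metis inf_le1 psubsetI psubset_card_mono)
    have sub: "(X \<inter> Y) <#> S \<subseteq> (X <#> S) \<inter> (Y <#> S)" by (auto simp: set_mult_def)
    have Un: "(X \<union> Y) <#> S = (X <#> S) \<union> (Y <#> S)" by (auto simp: set_mult_def)
    have IF: "X \<inter> Y \<in> F" using Xc ne sub mS by (auto simp: F_def)
    \<comment> \<open>The intersection is admissible but too small to be a minimiser, so its value
      of \<open>d\<close> is strictly above \<kappa>. Submodularity then pushes the union strictly
      below \<kappa>.\<close>
    have "X \<inter> Y \<notin> F'" using X1min lt a_def by fastforce
    then have "\<kappa> < d (X \<inter> Y)" using X0min[OF IF] IF by (auto simp: F'_def \<kappa>_def)
    then have I: "\<kappa> + int (card (X \<inter> Y)) < int (card ((X <#> S) \<inter> (Y <#> S)))"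
      using card_mono[OF _ sub] fs mS Xc by (fastforce simp: d_def)
    have e1: "card (X <#> S) + card (Y <#> S) = card ((X \<union> Y) <#> S) + card ((X <#> S) \<inter> (Y <#> S))"
      unfolding Un using fs mS Xc Yc by (intro card_Un_Int) auto
    have e2: "card X + card Y = card (X \<union> Y) + card (X \<inter> Y)"
      using fs Xc Yc by (intro card_Un_Int) auto
    have U: "d (X \<union> Y) < \<kappa>" using e1 e2 I Xc(4) Yc(4) by (simp add: d_def)
    show False
    proof (cases "(X \<union> Y) <#> S = carrier G")
      case True
      \<comment> \<open>The union is not admissible here, so minimality says nothing about it.
        Instead \<open>U\<close> gives |G| < \<kappa> + |X \<union> Y| \<le> \<kappa> + 2a, against
        \<open>big\<close>.\<close>
      then show False using e1 e2 I Xc(4) Yc(4) X(2) Y(2) big by (simp add: d_def)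
    next
      case False
      then have "X \<union> Y \<in> F" using Xc Yc by (auto simp: F_def)
      then show False using U X0min \<kappa>_def by fastforce
    qed
  qed
  obtain x where x: "x \<in> X1" "x \<in> carrier G" using X1 by (auto simp: F'_def F_def)
  define H where "H = inv x <# X1"
  have H: "H \<in> F'" "card H = a" using translate X1 x by (auto simp: H_def a_def)
  have Hc: "H \<subseteq> carrier G" "H \<noteq> {}" "H <#> S \<noteq> carrier G" "d H = \<kappa>" using H by (auto simp: F'_def F_def)
  have one: "\<one> \<in> H" using x by (force simp: H_def l_coset_def)
  \<comment> \<open>Both sets are atoms, and both contain the neutral element since
    \<open>inv h \<otimes> h = \<one>\<close>.\<close>
  have Hh: "inv h <# H = H" if "h \<in> H" for h
  proof (rule disj)
    have h: "h \<in> carrier G" using that Hc by auto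
    show "inv h <# H \<in> F'" "card (inv h <# H) = a" using translate H h by auto
    show "H \<in> F'" "card H = a" using H by auto
    have "\<one> \<in> inv h <# H" using that h by (force simp: l_coset_def)
    then show "(inv h <# H) \<inter> H \<noteq> {}" using one by blast
  qed
  have div: "inv h \<otimes> k \<in> H" if "h \<in> H" "k \<in> H" for h k
    using Hh[OF that(1)] that(2) by (auto simp: l_coset_def)
  have invH: "inv h \<in> H" if "h \<in> H" for h
    using div[OF that one] that Hc by auto
  have sg: "subgroup H G"
  proof (rule subgroupI)
    fix h k assume hk: "h \<in> H" "k \<in> H"
    then show "h \<otimes> k \<in> H" using div[OF invH[OF hk(1)] hk(2)] Hc by (simp add: subsetD)
  qed (use Hc invH in auto)
  show ?thesis
  proof (rule that[OF sg Hc(3)])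
    fix X assume "X \<subseteq> carrier G" "X \<noteq> {}" "X <#> S \<noteq> carrier G"
    then have "d H \<le> d X" using X0min Hc(4) by (auto simp: F_def \<kappa>_def)
    then show "card X + card (H <#> S) \<le> card (X <#> S) + card H" by (simp add: d_def)
  qed
qed

section \<open>Size of product-free sets\<close>

text \<open>\<open>S\<close> and its translate by \<open>h\<close> are disjoint, of equal size, and
  both inside \<open>K\<close>. \<open>K\<close> will be the whole group or
  \<open>H <#> S\<close>.\<close>

lemma card_product_free_le:
  assumes "finite (carrier G)" "K \<subseteq> carrier G" "S \<subseteq> K" "h \<in> S" "h <# S \<subseteq> K"
    and free: "S \<inter> (S <#> S) = {}"
  shows "2 * card S \<le> card K"
proof -
  have fK: "finite K" using assms finite_subset by blast
  have "h <# S \<subseteq> S <#> S" using \<open>h \<in> S\<close> by (auto simp: l_coset_def set_mult_def)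
  then have "S \<inter> (h <# S) = {}" using free by blast
  moreover have "finite S" "finite (h <# S)"
    using finite_subset[OF _ fK] assms(3,5) by auto
  ultimately have "card (S \<union> (h <# S)) = card S + card (h <# S)"
    by (simp add: card_Un_disjoint)
  moreover have "card (h <# S) = card S" using assms by (intro card_l_coset) auto
  moreover have "card (S \<union> (h <# S)) \<le> card K" using assms fK by (intro card_mono) auto
  ultimately show ?thesis by simp
qed

text \<open>\<open>H <#> S\<close> is a disjoint union of cosets of \<open>H\<close>.\<close>

lemma card_subgroup_set_mult:
  assumes fin: "finite (carrier G)" and H: "subgroup H G" and S: "S \<subseteq> carrier G"
  shows "card H dvd card (H <#> S)"
proof -
  interpret H: subgroup H G by fact
  define C where "C = (\<lambda>s. H #> s) ` S"
  have HS: "H <#> S = \<Union>C" by (auto simp: C_def set_mult_def r_coset_def)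
  have CR: "C \<subseteq> rcosets H" using S by (auto simp: C_def RCOSETS_def)
  have fS: "finite S" using S fin finite_subset by blast
  have "card H * card C = card (\<Union>C)"
  proof (rule card_partition)
    show "finite C" using fS C_def by auto
    show "finite (\<Union>C)" unfolding HS[symmetric]
      using fin S H.subset setmult_subset_G finite_subset by meson
    show "card c = card H" if "c \<in> C" for c using card_rcosets_equal that CR H.subset by fastforce
    show "c1 \<inter> c2 = {}" if "c1 \<in> C" "c2 \<in> C" "c1 \<noteq> c2" for c1 c2
      using rcos_disjoint[OF H] that CR by (auto simp: pairwise_def disjnt_def)
  qed
  then show ?thesis by (metis HS dvd_triv_left)
qed

lemma inv_eq_self_odd_order:
  assumes "odd (order G)" "x \<in> carrier G" "inv x = x" shows "x = \<one>"
proof -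
  obtain k where k: "order G = 2 * k + 1" using assms oddE by blast
  have "x [^] (2::nat) = \<one>" using assms by (metis nat_pow_Suc nat_pow_0 l_one numeral_2_eq_2 r_inv)
  then have "x [^] order G = x" using assms(2) k by (simp add: nat_pow_mult[symmetric] nat_pow_pow[symmetric])
  then show ?thesis using pow_order_eq_1[OF assms(2)] by simp
qed

theorem card_symmetric_product_free_odd_order:
  assumes odd: "odd (order G)"
    and S: "S \<subseteq> carrier G" and sym: "\<And>x. x \<in> S \<Longrightarrow> inv x \<in> S"
    and free: "S \<inter> (S <#> S) = {}"
  shows "3 * card S \<le> order G \<or>
    (\<exists>m. m dvd order G \<and> m mod 6 = 5 \<and> 3 * m * card S \<le> (m + 1) * order G)"
proof (cases "S = {}")
  case False
  have fin: "finite (carrier G)" using odd order_gt_0_iff_finite by (metis even_zero gr0I)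
  have one: "\<one> \<notin> S"
  proof
    assume "\<one> \<in> S"
    then have "\<one> \<otimes> \<one> \<in> S <#> S" by (intro set_multI)
    then show False using free \<open>\<one> \<in> S\<close> by auto
  qed
  then have "S \<noteq> carrier G" by auto
  then obtain H where H: "subgroup H G" "H <#> S \<noteq> carrier G" and
    Hmin: "\<And>X. \<lbrakk>X \<subseteq> carrier G; X \<noteq> {}; X <#> S \<noteq> carrier G\<rbrakk>
        \<Longrightarrow> card X + card (H <#> S) \<le> card (X <#> S) + card H"
    using isoperimetric_subgroup[OF fin S _ sym] by blast
  interpret H: subgroup H G by fact
  define h where "h = card H"
  define K where "K = H <#> S"
  have Kc: "K \<subseteq> carrier G" unfolding K_def using H.subset S setmult_subset_G by blast
  have fS: "finite S" "finite H" "finite K" using S H.subset Kc fin finite_subset by blast+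
  have SK: "S \<subseteq> K"
  proof
    fix s assume "s \<in> S"
    then show "s \<in> K" using S set_multI[of \<one> H s S] by (auto simp: K_def)
  qed
  have SS: "S <#> S \<subseteq> carrier G" using S setmult_subset_G by blast
  have "card S + card (S <#> S) \<le> order G"
    unfolding order_def using free S SS fin
    by (metis card_Un_disjoint card_mono finite_subset le_sup_iff)
  \<comment> \<open>The choice X = S is admissible because \<open>S <#> S\<close> misses the
    nonempty set \<open>S\<close>.\<close>
  moreover have "card S + card K \<le> card (S <#> S) + h"
    using Hmin[of S] S False free by (auto simp: K_def h_def)
  ultimately have main: "2 * card S + card K \<le> order G + h" by linarith
  obtain m where m: "order G = m * h" using lagrange[OF H(1)] h_def by metis
  have oddm: "odd m" "odd h" using odd m by auto
  show ?thesis
  proof (cases "S \<inter> H = {}")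
    case False
    then obtain g where g: "g \<in> S" "g \<in> H" by blast
    have "2 * card S \<le> card K"
    proof (rule card_product_free_le[OF fin Kc SK g(1) _ free])
      show "g <# S \<subseteq> K" using g by (auto simp: K_def l_coset_def set_mult_def)
    qed
    \<comment> \<open>For m = 1 the subgroup is everything and \<open>H <#> S\<close> would be the
      whole group. So the odd number m is at least 3, and 4|S| \<le> |G| + h \<le> (4/3)|G|.\<close>
    moreover have "m \<noteq> 1"
    proof
      assume "m = 1"
      then have "H = carrier G"
        using m fin H.subset card_subset_eq by (metis h_def mult_1 order_def)
      have "z \<in> K" if "z \<in> carrier G" for z
        using set_multI[of "z \<otimes> inv g" H g S] that g S \<open>H = carrier G\<close> by (auto simp: K_def m_assoc)
      then show False using H(2) Kc by (auto simp: K_def)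
    qed
    then have "3 * h \<le> order G" using m oddm mult_le_mono1[of 3 m h] by (cases "m = 2") (auto elim: oddE)
    ultimately show ?thesis using main by linarith
  next
    case True
    obtain k where k: "card K = k * h"
      using card_subgroup_set_mult[OF fin H(1) S] by (metis K_def dvdE h_def mult.commute)
    \<comment> \<open>In odd order only the neutral element is its own inverse; if it were
      \<open>a \<otimes> s\<close> with \<open>a\<close> in \<open>H\<close>, then \<open>s\<close>
      would lie in \<open>H\<close>. Hence inversion has no fixed point on \<open>K\<close>. As h is
      odd, evenness passes to k.\<close>
    have "even (card K)"
    proof (rule even_card_fixpoint_free_involution[where f = "\<lambda>x. inv x"])
      fix x assume x: "x \<in> K"
      then obtain a s where as: "a \<in> H" "s \<in> S" "x = a \<otimes> s" unfolding K_def by (rule set_multE)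
      have c: "a \<in> carrier G" "s \<in> carrier G" using as S by auto
      have "inv x = inv a \<otimes> inv s" using as c by (simp add: inv_mult)
      then show "inv x \<in> K" using as sym by (auto simp: K_def intro!: set_multI)
      show "inv x \<noteq> x"
      proof
        assume "inv x = x"
        then have "x = \<one>" using inv_eq_self_odd_order odd x Kc by blast
        then have "s = inv a" using as c by (metis inv_equality inv_inv m_comm)
        then show False using True as by auto
      qed
    qed (use fS Kc in auto)
    then have "even k" using k oddm by simp
    moreover have "card S \<le> k * h" using k card_mono SK fS by metis
    ultimately have "3 * card S \<le> m * h \<or> m mod 6 = 5 \<and> 3 * card S \<le> (m + 1) * h"
      using card_bound_arith[of "card S" k h m] main m k oddm by simp
    then show ?thesis
    proof
      assume "m mod 6 = 5 \<and> 3 * card S \<le> (m + 1) * h"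
      moreover from this have "m * (3 * card S) \<le> m * ((m + 1) * h)" by (intro mult_le_mono2) simp
      ultimately show ?thesis using m by (intro disjI2 exI[of _ m]) (simp add: algebra_simps)
    qed (simp add: m)
  qed
qed simp

end

section \<open>Independence in the cyclic group as divisibility\<close>

lemma finprod_integer_mod_group:
  assumes "n > 0" "finite A"
  shows "finprod (integer_mod_group n) (\<lambda>a. a [^]\<^bsub>integer_mod_group n\<^esub> (l a :: int)) A = (\<Sum>a\<in>A. l a * a) mod int n"
proof -
  interpret G: comm_group "integer_mod_group n" by simp
  show ?thesis
    using assms(2)
  proof (induction A)
    case (insert a A)
    have "(\<lambda>a. a [^]\<^bsub>integer_mod_group n\<^esub> (l a :: int)) \<in> insert a A \<rightarrow> carrier (integer_mod_group n)"
      using assms(1) by (auto simp: int_pow_integer_mod_group carrier_integer_mod_group)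
    with insert show ?case
      by (simp add: Pi_iff int_pow_integer_mod_group mod_add_eq)
  qed simp
qed

lemma t_independent_integer_mod_group:
  assumes "n > 0"
  shows "t_independent (integer_mod_group n) t A \<longleftrightarrow>
    finite A \<and> A \<noteq> {} \<and> A \<subseteq> {0..<int n} \<and>
    (\<forall>l. int n dvd (\<Sum>a\<in>A. l a * a) \<and> (\<Sum>a\<in>A. \<bar>l a\<bar>) \<le> int t \<longrightarrow> (\<forall>a\<in>A. l a = 0))"
proof (cases "finite A")
  case True
  show ?thesis
    using assms unfolding t_independent_def finprod_integer_mod_group[OF assms True]
    by (simp add: True carrier_integer_mod_group dvd_eq_mod_eq_0)
qed (simp add: t_independent_def)

text \<open>Independent sets are nonempty, so an upper bound of 0 means that there are none, and the
  default value 0 applies. A witness is therefore asked for only when \<open>v > 0\<close>.\<close>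

lemma max_independent_size_eqI:
  assumes ex: "v > 0 \<Longrightarrow> \<exists>A. t_independent G t A \<and> card A = v"
    and le: "\<And>A. t_independent G t A \<Longrightarrow> card A \<le> v"
  shows "max_independent_size G t = v"
proof (cases "\<exists>A. t_independent G t A")
  case True
  then obtain B where "t_independent G t B" by blast
  moreover from this have "card B > 0" by (auto simp: t_independent_def card_gt_0_iff)
  ultimately obtain A where A: "t_independent G t A" "card A = v"
    using ex le by fastforce
  have "Max {card A |A. t_independent G t A} = v"
  proof (rule Max_eqI)
    show "finite {card A |A. t_independent G t A}"
      using le by (auto intro: finite_subset[of _ "{..v}"])
  qed (use A le in auto)
  with True show ?thesis by (simp add: max_independent_size_def)
next
  case False
  then have "v = 0" using ex by auto
  with False show ?thesis by (simp add: max_independent_size_def)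
qed

section \<open>Upper bounds from symmetric sum-free sets\<close>

text \<open>The elements a, b, c may coincide, so their coefficients are accumulated in one family.
  The nonzero total of the coefficients ensures that they do not all cancel.\<close>

lemma t_independent_3D:
  fixes n :: nat and e\<^sub>1 e\<^sub>2 e\<^sub>3 :: int
  assumes "n > 0" and indep: "t_independent (integer_mod_group n) 3 A"
    and "a \<in> A" "b \<in> A" "c \<in> A" and e: "\<bar>e\<^sub>1\<bar> \<le> 1" "\<bar>e\<^sub>2\<bar> \<le> 1" "\<bar>e\<^sub>3\<bar> \<le> 1" "e\<^sub>1 + e\<^sub>2 + e\<^sub>3 \<noteq> 0"
  shows "\<not> int n dvd e\<^sub>1 * a + e\<^sub>2 * b + e\<^sub>3 * c"
proof
  assume dvd: "int n dvd e\<^sub>1 * a + e\<^sub>2 * b + e\<^sub>3 * c"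
  have fin: "finite A" using indep by (simp add: t_independent_def)
  define l where "l x = (if x = a then e\<^sub>1 else 0) + (if x = b then e\<^sub>2 else 0) + (if x = c then e\<^sub>3 else 0)" for x
  have "l x * x = (if x = a then e\<^sub>1 * a else 0) + (if x = b then e\<^sub>2 * b else 0) + (if x = c then e\<^sub>3 * c else 0)" for x
    by (simp add: l_def algebra_simps)
  then have "(\<Sum>x\<in>A. l x * x) = e\<^sub>1 * a + e\<^sub>2 * b + e\<^sub>3 * c"
    using fin assms by (simp add: sum.distrib)
  moreover have "(\<Sum>x\<in>A. \<bar>l x\<bar>) \<le> (\<Sum>x\<in>A. (if x = a then 1 else 0) + (if x = b then 1 else 0) + (if x = c then 1 else 0))"
    using e by (intro sum_mono) (auto simp: l_def)
  then have "(\<Sum>x\<in>A. \<bar>l x\<bar>) \<le> int 3"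
    using fin assms by (simp add: sum.distrib)
  ultimately have "\<forall>x\<in>A. l x = 0"
    using indep dvd \<open>n > 0\<close> by (simp add: t_independent_integer_mod_group)
  then have "(\<Sum>x\<in>A. l x) = 0" by simp
  moreover have "(\<Sum>x\<in>A. l x) = e\<^sub>1 + e\<^sub>2 + e\<^sub>3"
    using fin assms by (simp add: l_def sum.distrib)
  ultimately show False using e by simp
qed

lemma symmetric_sum_free_of_t_independent_3:
  assumes n: "n > 0" and indep: "t_independent (integer_mod_group n) 3 A"
  obtains S where "S \<subseteq> carrier (integer_mod_group n)" "card S = 2 * card A"
    "\<And>x. x \<in> S \<Longrightarrow> inv\<^bsub>integer_mod_group n\<^esub> x \<in> S"
    "S \<inter> (S <#>\<^bsub>integer_mod_group n\<^esub> S) = {}"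
proof -
  have A: "finite A" "A \<noteq> {}" "A \<subseteq> {0..<int n}"
    using indep n by (auto simp: t_independent_integer_mod_group)
  define f where "f x = (- x) mod int n" for x
  define S where "S = A \<union> f ` A"
  have ff: "f (f a) = a" if "a \<in> A" for a
    using that A by (auto simp: f_def mod_minus_eq)
  have "inj_on f A" by (metis ff inj_onI)
  moreover have "A \<inter> f ` A = {}"
  proof (rule ccontr)
    assume "A \<inter> f ` A \<noteq> {}"
    then obtain a b where ab: "a \<in> A" "b \<in> A" "a = f b" by blast
    \<comment> \<open>The third coefficient is 0: this is a relation with two terms, put in the
      three-term form.\<close>
    then have "int n dvd 1 * a + 1 * b + 0 * b"
      by (simp add: f_def dvd_eq_mod_eq_0 mod_add_left_eq)
    moreover have "\<not> int n dvd 1 * a + 1 * b + 0 * b"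
      using ab by (intro t_independent_3D[OF n indep]) auto
    ultimately show False by blast
  qed
  ultimately have card: "card S = 2 * card A"
    using A(1) by (simp add: S_def card_Un_disjoint card_image)
  have sign: "\<exists>e a. a \<in> A \<and> (e = 1 \<or> e = -1) \<and> [x = e * a] (mod int n)" if "x \<in> S" for x
  proof -
    from that consider "x \<in> A" | a where "a \<in> A" "x = f a" by (auto simp: S_def)
    then show ?thesis
    proof cases
      case 1
      then show ?thesis by (intro exI[of _ 1] exI[of _ x]) simp
    next
      case 2
      then show ?thesis by (intro exI[of _ "-1"] exI[of _ a]) (simp add: f_def cong_def)
    qed
  qed
  have free: "S \<inter> (S <#>\<^bsub>integer_mod_group n\<^esub> S) = {}"
  proof (rule ccontr)
    assume "S \<inter> (S <#>\<^bsub>integer_mod_group n\<^esub> S) \<noteq> {}"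
    then obtain x y z where xyz: "x \<in> S" "y \<in> S" "z \<in> S" "z = (x + y) mod int n"
      by (auto simp: set_mult_def)
    obtain e a where a: "a \<in> A" "e = 1 \<or> e = -1" "[x = e * a] (mod int n)" using sign xyz by blast
    obtain e' b where b: "b \<in> A" "e' = 1 \<or> e' = -1" "[y = e' * b] (mod int n)" using sign xyz by blast
    obtain e'' c where c: "c \<in> A" "e'' = 1 \<or> e'' = -1" "[z = e'' * c] (mod int n)" using sign xyz by blast
    have "[x + y - z = e * a + e' * b - e'' * c] (mod int n)"
      using a b c by (intro cong_add cong_diff) auto
    moreover have "[x + y - z = 0] (mod int n)"
      using xyz by (simp add: cong_def mod_diff_right_eq)
    ultimately have "[e * a + e' * b - e'' * c = 0] (mod int n)"
      using cong_sym cong_trans by blast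
    then have "int n dvd e * a + e' * b + (- e'') * c" by (simp add: cong_0_iff)
    \<comment> \<open>A sum of three signs is odd, hence nonzero, even if some of a, b, c are
      equal.\<close>
    moreover have "\<not> int n dvd e * a + e' * b + (- e'') * c"
      using a b c by (intro t_independent_3D[OF n indep]) auto
    ultimately show False by blast
  qed
  have Sc: "S \<subseteq> carrier (integer_mod_group n)"
    using A n by (auto simp: S_def f_def carrier_integer_mod_group)
  show ?thesis
  proof (rule that[OF Sc card _ free])
    fix x assume "x \<in> S"
    then show "inv\<^bsub>integer_mod_group n\<^esub> x \<in> S"
      using Sc ff by (auto simp: S_def f_def[symmetric])
  qed
qed

lemma order_integer_mod_group: "n > 0 \<Longrightarrow> order (integer_mod_group n) = n"
  by (simp add: order_def carrier_integer_mod_group)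

text \<open>With the whole group as ambient set, 4|A| = 2|S| \<le> n. For even n this bound is the
  exact value.\<close>

lemma t_independent_3_card_le_even:
  assumes n: "n > 0" and indep: "t_independent (integer_mod_group n) 3 A"
  shows "card A \<le> n div 4"
proof -
  interpret G: comm_group "integer_mod_group n" by simp
  obtain S where S: "S \<subseteq> carrier (integer_mod_group n)" "card S = 2 * card A"
    "S \<inter> (S <#>\<^bsub>integer_mod_group n\<^esub> S) = {}"
    using symmetric_sum_free_of_t_independent_3[OF n indep] by metis
  have "card A > 0" using indep by (auto simp: t_independent_def card_gt_0_iff)
  then obtain h where h: "h \<in> S" using S(2) by fastforce
  have "2 * card S \<le> card (carrier (integer_mod_group n))"
    using S h n by (intro G.card_product_free_le[of _ S h])
      (auto simp: carrier_integer_mod_group l_coset_def)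
  then show ?thesis using S(2) n by (simp add: carrier_integer_mod_group)
qed

lemma t_independent_3_card_le_odd:
  assumes odd: "odd n" and indep: "t_independent (integer_mod_group n) 3 A"
  shows "6 * card A \<le> n \<or> (\<exists>m. m dvd n \<and> m mod 6 = 5 \<and> 6 * m * card A \<le> (m + 1) * n)"
proof -
  have n: "n > 0" using odd by (rule odd_pos)
  interpret G: comm_group "integer_mod_group n" by simp
  obtain S where S: "S \<subseteq> carrier (integer_mod_group n)" "card S = 2 * card A"
    "\<And>x. x \<in> S \<Longrightarrow> inv\<^bsub>integer_mod_group n\<^esub> x \<in> S"
    "S \<inter> (S <#>\<^bsub>integer_mod_group n\<^esub> S) = {}"
    using symmetric_sum_free_of_t_independent_3[OF n indep] by blast
  show ?thesis
    using G.card_symmetric_product_free_odd_order[OF _ S(1) S(3) S(4)] odd n S(2)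
    by (simp add: order_integer_mod_group mult.assoc)
qed

section \<open>Construction of 3-independent sets\<close>

text \<open>Moving a nonzero coefficient one step towards 0 lowers the weight by exactly 1.
  Repetition writes a combination of weight k as a sum of k signed elements.\<close>

lemma remove_signed_unit:
  fixes l :: "'a \<Rightarrow> int"
  assumes "finite A" "(\<Sum>a\<in>A. \<bar>l a\<bar>) = int (Suc k)"
  obtains a e l' where "a \<in> A" "e = 1 \<or> e = -1" "(\<Sum>a\<in>A. \<bar>l' a\<bar>) = int k"
    "l = (\<lambda>x. l' x + (if x = a then e else 0))"
proof -
  have "\<exists>a\<in>A. l a \<noteq> 0"
  proof (rule ccontr)
    assume "\<not> ?thesis"
    then have "(\<Sum>a\<in>A. \<bar>l a\<bar>) = 0" by simp
    with assms show False by simp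
  qed
  then obtain a where a: "a \<in> A" "l a \<noteq> 0" by blast
  define l' where "l' = l(a := l a - sgn (l a))"
  have "\<bar>l x\<bar> = \<bar>l' x\<bar> + (if x = a then 1 else 0)" for x
    using a by (auto simp: l'_def sgn_if)
  then have "(\<Sum>a\<in>A. \<bar>l a\<bar>) = (\<Sum>a\<in>A. \<bar>l' a\<bar>) + 1"
    using assms(1) a by (simp add: sum.distrib)
  then show ?thesis
    using that[of a "sgn (l a)" l'] a assms(2) by (auto simp: l'_def sgn_if fun_eq_iff)
qed

text \<open>Up to a global sign, a combination of weight at most 3 is a, a + b, a - b, a + b + c or
  a + b - c. The first is covered by a + a, and a - b vanishes modulo n only for a = b since
  \<open>A\<close> consists of reduced residues.\<close>

lemma t_independent_3I:
  fixes n :: nat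
  assumes n: "n > 0" and A: "A \<noteq> {}" "A \<subseteq> {0..<int n}"
    and two: "\<And>a b. a \<in> A \<Longrightarrow> b \<in> A \<Longrightarrow> \<not> int n dvd a + b"
    and three: "\<And>a b c. a \<in> A \<Longrightarrow> b \<in> A \<Longrightarrow> c \<in> A \<Longrightarrow> \<not> int n dvd a + b + c"
      "\<And>a b c. a \<in> A \<Longrightarrow> b \<in> A \<Longrightarrow> c \<in> A \<Longrightarrow> \<not> int n dvd a + b - c"
  shows "t_independent (integer_mod_group n) 3 A"
proof -
  have fin: "finite A" using A finite_subset by blast
  have "\<forall>a\<in>A. l a = 0" if l: "int n dvd (\<Sum>a\<in>A. l a * a)" "(\<Sum>a\<in>A. \<bar>l a\<bar>) \<le> int 3" for l :: "int \<Rightarrow> int"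
  proof (rule ccontr)
    have add: "(\<Sum>x\<in>A. (l' x + (if x = a then e else 0)) * x) = (\<Sum>x\<in>A. l' x * x) + e * a"
      if "a \<in> A" for l' :: "int \<Rightarrow> int" and a e
    proof -
      have "(l' x + (if x = a then e else 0)) * x = l' x * x + (if x = a then e * a else 0)" for x
        by (simp add: algebra_simps)
      then show ?thesis using that fin by (simp add: sum.distrib)
    qed
    have zero: "\<forall>x\<in>A. l' x = 0" if "(\<Sum>x\<in>A. \<bar>l' x\<bar>) = int 0" for l' :: "int \<Rightarrow> int"
      using that fin by (simp add: sum_nonneg_eq_0_iff)
    assume nz: "\<not> (\<forall>a\<in>A. l a = 0)"
    obtain k where k: "(\<Sum>a\<in>A. \<bar>l a\<bar>) = int k" by (metis abs_ge_zero sum_nonneg zero_le_imp_eq_int)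
    have "k \<noteq> 0" using nz zero k by metis
    then consider "k = Suc 0" | "k = Suc (Suc 0)" | "k = Suc (Suc (Suc 0))" using k l by linarith
    then show False
    proof cases
      case 1
      obtain a e l1 where a: "a \<in> A" "e = 1 \<or> e = -1" "(\<Sum>a\<in>A. \<bar>l1 a\<bar>) = int 0"
        "l = (\<lambda>x. l1 x + (if x = a then e else 0))"
          by (rule remove_signed_unit[OF fin k[unfolded 1]])
      then have "int n dvd e * a" using l(1) zero[OF a(3)] add[OF a(1), of l1 e] by simp
      then have "int n dvd a + a" using a(2) by auto
      then show False using two a by blast
    next
      case 2
      obtain a e l1 where a: "a \<in> A" "e = 1 \<or> e = -1" "(\<Sum>a\<in>A. \<bar>l1 a\<bar>) = int (Suc 0)"
        "l = (\<lambda>x. l1 x + (if x = a then e else 0))"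
          by (rule remove_signed_unit[OF fin k[unfolded 2]])
      obtain b e' l2 where b: "b \<in> A" "e' = 1 \<or> e' = -1" "(\<Sum>a\<in>A. \<bar>l2 a\<bar>) = int 0"
        "l1 = (\<lambda>x. l2 x + (if x = b then e' else 0))"
          by (rule remove_signed_unit[OF fin a(3)])
      have d: "int n dvd e' * b + e * a"
        using l(1) zero[OF b(3)] add[OF a(1), of l1 e] add[OF b(1), of l2 e'] a(4) b(4) by simp
      show False
      proof (cases "e = e'")
        case True
        then have "int n dvd a + b" using d a(2) dvd_minus_iff[of "int n" "a + b"] by (auto simp: algebra_simps)
        then show False using two a b by blast
      next
        case False
        then have "int n dvd a - b" using d a(2) b(2) dvd_minus_iff[of "int n" "a - b"] by (auto simp: algebra_simps)
        moreover have "a \<in> {0..<int n}" "b \<in> {0..<int n}" using a b A by auto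
        ultimately have "a = b" by (simp add: mod_eq_dvd_iff[symmetric])
        \<comment> \<open>With a = b and opposite signs the two units cancel, so \<open>l\<close> is
          zero on \<open>A\<close>.\<close>
        then show False using a(2,4) b(2,4) zero[OF b(3)] False nz by (auto split: if_splits)
      qed
    next
      case 3
      obtain a e l1 where a: "a \<in> A" "e = 1 \<or> e = -1" "(\<Sum>a\<in>A. \<bar>l1 a\<bar>) = int (Suc (Suc 0))"
        "l = (\<lambda>x. l1 x + (if x = a then e else 0))"
          by (rule remove_signed_unit[OF fin k[unfolded 3]])
      obtain b e' l2 where b: "b \<in> A" "e' = 1 \<or> e' = -1" "(\<Sum>a\<in>A. \<bar>l2 a\<bar>) = int (Suc 0)"
        "l1 = (\<lambda>x. l2 x + (if x = b then e' else 0))"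
          by (rule remove_signed_unit[OF fin a(3)])
      obtain c e'' l3 where c: "c \<in> A" "e'' = 1 \<or> e'' = -1" "(\<Sum>a\<in>A. \<bar>l3 a\<bar>) = int 0"
        "l2 = (\<lambda>x. l3 x + (if x = c then e'' else 0))"
          by (rule remove_signed_unit[OF fin b(3)])
      have d: "int n dvd e'' * c + e' * b + e * a"
        using l(1) zero[OF c(3)] add[OF a(1), of l1 e] add[OF b(1), of l2 e'] add[OF c(1), of l3 e'']
          a(4) b(4) c(4) by simp
      have neg: "int n dvd - x \<longleftrightarrow> int n dvd x" for x by simp
      \<comment> \<open>Either all three signs agree or exactly one differs; a global sign does not
        affect divisibility.\<close>
      have "int n dvd a + b + c \<or> int n dvd a + b - c \<or> int n dvd a + c - b \<or> int n dvd b + c - a"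
        using d a(2) b(2) c(2) neg[of "a + b + c"] neg[of "a + b - c"] neg[of "a + c - b"] neg[of "b + c - a"]
        by (elim disjE) (simp_all add: algebra_simps)
      then show False using three a(1) b(1) c(1) by blast
    qed
  qed
  then show ?thesis using n A fin by (simp add: t_independent_integer_mod_group)
qed

text \<open>Combinations of three odd numbers with signs are odd, so the even n does not divide
  them; sums of two lie strictly between 0 and n.\<close>

lemma t_independent_3_odds:
  assumes "even n" "n div 4 > 0"
  shows "\<exists>A. t_independent (integer_mod_group n) 3 A \<and> card A = n div 4"
proof (intro exI conjI)
  define A where "A = (\<lambda>i. 2 * int i + 1) ` {..<n div 4}"
  show "card A = n div 4" by (simp add: A_def card_image inj_on_def)
  have n: "n > 0" using assms by (cases n) auto
  have A: "odd a \<and> 0 < a \<and> 2 * a < int n" if "a \<in> A" for a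
    using that by (auto simp: A_def)
  have even_dvd: "even x" if "int n dvd x" for x
    using that assms(1) by (meson dvd_trans even_of_nat)
  show "t_independent (integer_mod_group n) 3 A"
  proof (rule t_independent_3I[OF n])
    show "A \<noteq> {}" using assms by (auto simp: A_def)
    show "A \<subseteq> {0..<int n}" using A by force
    show "\<not> int n dvd a + b" if "a \<in> A" "b \<in> A" for a b
      using A[OF that(1)] A[OF that(2)] by (intro zdvd_not_zless) auto
    show "\<not> int n dvd a + b + c" "\<not> int n dvd a + b - c" if "a \<in> A" "b \<in> A" "c \<in> A" for a b c
      using A[OF that(1)] A[OF that(2)] A[OF that(3)] by (auto dest!: even_dvd)
  qed
qed

text \<open>For residues r, s, t strictly between m/3 and m/2, r + s lies in (2m/3, m), r + s + t in
  (m, 3m/2) and r + s - t in (m/6, 2m/3). None of these contains a multiple of m, hence n divides no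
  such combination.\<close>

lemma t_independent_3_middle_sixth:
  assumes n: "n = m * q" and m: "m > 0" and pos: "q * ((m - 1) div 2 - m div 3) > 0"
  shows "\<exists>A. t_independent (integer_mod_group n) 3 A \<and> card A = q * ((m - 1) div 2 - m div 3)"
proof (intro exI conjI)
  \<comment> \<open>These are the integers with m/3 < r < m/2; the m - 1 excludes r = m/2.\<close>
  define I where "I = {m div 3<..(m - 1) div 2}"
  define g where "g = (\<lambda>(i, r). int (m * i + r))"
  define A where "A = g ` ({..<q} \<times> I)"
  have I: "m < 3 * r \<and> 2 * r < m" if "r \<in> I" for r
    using that m by (auto simp: I_def)
  have "inj_on g ({..<q} \<times> I)"
  proof (rule inj_onI, clarify)
    fix i r i' r' assume r: "r \<in> I" "r' \<in> I" and "g (i, r) = g (i', r')"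
    then have eq: "m * i + r = m * i' + r'" by (simp add: g_def del: of_nat_add of_nat_mult)
    have lt: "r < m" "r' < m" using I r by fastforce+
    have "r = r'" using arg_cong[OF eq, of "\<lambda>x. x mod m"] lt by simp
    with eq m show "i = i' \<and> r = r'" by simp
  qed
  then show card: "card A = q * ((m - 1) div 2 - m div 3)"
    by (simp add: A_def card_image card_cartesian_product I_def)
  have n0: "n > 0" using pos m n by (cases q) auto
  have A: "\<exists>r i. a = int m * i + r \<and> int m < 3 * r \<and> 2 * r < int m" if "a \<in> A" for a
  proof -
    obtain i r where "r \<in> I" "a = int (m * i + r)" using \<open>a \<in> A\<close> by (auto simp: A_def g_def)
    then show ?thesis using I[of r] by (intro exI[of _ "int r"] exI[of _ "int i"]) auto
  qed
  have dvd: "int m dvd x" if "int n dvd x" for x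
    using that n by (metis dvd_mult_left of_nat_mult)
  have shift: "int m dvd y" if "int m dvd int m * x + y" for x y
    using that by (metis dvd_add_right_iff dvd_triv_left)
  show "t_independent (integer_mod_group n) 3 A"
  proof (rule t_independent_3I[OF n0])
    show "A \<noteq> {}" using card pos by auto
    show "A \<subseteq> {0..<int n}"
    proof
      fix a assume "a \<in> A"
      then obtain i r where ir: "i < q" "r \<in> I" "a = int (m * i + r)" by (auto simp: A_def g_def)
      have "m * (i + 1) \<le> m * q" using ir by (intro mult_le_mono2) simp
      then have "m * i + r < n" using I[OF ir(2)] n by simp
      then show "a \<in> {0..<int n}" unfolding ir(3) by (simp del: of_nat_add of_nat_mult)
    qed
    show "\<not> int n dvd a + b" if ab: "a \<in> A" "b \<in> A" for a b
    proof
      assume d: "int n dvd a + b"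
      obtain i r where r: "a = int m * i + r" "int m < 3 * r" "2 * r < int m" using A ab by blast
      obtain j s where s: "b = int m * j + s" "int m < 3 * s" "2 * s < int m" using A ab by blast
      have "int m dvd int m * (i + j) + (r + s)" using dvd[OF d] r s by (simp add: algebra_simps)
      then have "int m dvd r + s" by (rule shift)
      then show False using zdvd_not_zless[of "r + s" "int m"] r s by linarith
    qed
    fix a b c assume abc: "a \<in> A" "b \<in> A" "c \<in> A"
    obtain i r where r: "a = int m * i + r" "int m < 3 * r" "2 * r < int m" using A abc by blast
    obtain j s where s: "b = int m * j + s" "int m < 3 * s" "2 * s < int m" using A abc by blast
    obtain k t where t: "c = int m * k + t" "int m < 3 * t" "2 * t < int m" using A abc by blast
    show "\<not> int n dvd a + b + c"
    proof
      assume d: "int n dvd a + b + c"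
      \<comment> \<open>One m is moved into the multiple so that the remainder term lies strictly
        between 0 and m.\<close>
      have "int m dvd int m * (i + j + k + 1) + (r + s + t - int m)"
        using dvd[OF d] r s t by (simp add: algebra_simps)
      then have "int m dvd r + s + t - int m" by (rule shift)
      then show False using zdvd_not_zless[of "r + s + t - int m" "int m"] r s t by linarith
    qed
    show "\<not> int n dvd a + b - c"
    proof
      assume d: "int n dvd a + b - c"
      have "int m dvd int m * (i + j - k) + (r + s - t)" using dvd[OF d] r s t by (simp add: algebra_simps)
      then have "int m dvd r + s - t" by (rule shift)
      then show False using zdvd_not_zless[of "r + s - t" "int m"] r s t by linarith
    qed
  qed
qed

section \<open>Primes congruent to 5 modulo 6 and the value of the maximum\<close>

text \<open>A product congruent to 5 modulo 6 has a factor congruent to 5, so either the split-off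
  prime works or the smaller cofactor inherits the property.\<close>

lemma prime_factor_5_mod_6:
  fixes m :: nat
  assumes "m mod 6 = 5"
  shows "\<exists>p. prime p \<and> p dvd m \<and> [p = 5] (mod 6)"
  using assms
proof (induction m rule: less_induct)
  case (less m)
  then have "m \<noteq> 1" by auto
  then obtain p where p: "prime p" "p dvd m" using prime_factor_nat by blast
  then obtain q where q: "m = p * q" by blast
  have mq: "((p mod 6) * (q mod 6)) mod 6 = 5" using less.prems q by (simp add: mod_mult_eq)
  have "p mod 6 < 6" "q mod 6 < 6" by simp_all
  then have "p mod 6 \<in> {0,1,2,3,4,5}" "q mod 6 \<in> {0,1,2,3,4,5}" by auto
  then consider "p mod 6 = 5" | "q mod 6 = 5" using mq by auto
  then show ?case
  proof cases
    case 1
    then show ?thesis using p by (intro exI[of _ p]) (simp add: cong_def)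
  next
    case 2
    then have "q > 0" by (cases q) auto
    then have "q < m" using q prime_gt_1_nat[OF p(1)] by simp
    then show ?thesis using less.IH 2 q by (meson dvd_mult dvd_trans dvd_triv_right)
  qed
qed

theorem theorem4:
  fixes n :: nat
  assumes "n \<ge> 2"
  shows "real (max_independent_size (integer_mod_group n) 3) =
    (if even n then of_int \<lfloor>real n / 4\<rfloor>
     else if \<exists>p :: nat. prime p \<and> p dvd n \<and> [p = 5] (mod 6) then
       (let p = (LEAST p :: nat. prime p \<and> p dvd n \<and> [p = 5] (mod 6))
        in (1 + 1 / real p) * (real n / 6))
     else of_int \<lfloor>real n / 6\<rfloor>)"
proof -
  let ?M = "max_independent_size (integer_mod_group n) 3"
  let ?P = "\<lambda>p :: nat. prime p \<and> p dvd n \<and> [p = 5] (mod 6)"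
  have n: "n > 0" using assms by simp
  have floor: "real_of_int \<lfloor>real n / real k\<rfloor> = real (n div k)" for k
    by (simp add: floor_divide_of_nat_eq)
  consider "even n" | "odd n" "\<exists>p. ?P p" | "odd n" "\<nexists>p. ?P p" by blast
  then show ?thesis
  proof cases
    case 1
    have "?M = n div 4"
      using 1 n t_independent_3_odds t_independent_3_card_le_even
      by (intro max_independent_size_eqI) auto
    then show ?thesis using 1 floor[of 4] by simp
  next
    case 2
    define p where "p = (LEAST p. ?P p)"
    have p: "prime p" "p dvd n" "[p = 5] (mod 6)" using LeastI_ex[OF 2(2)] by (simp_all add: p_def)
    have p5: "p mod 6 = 5" using p(3) by (simp add: cong_def)
    obtain q where q: "n = p * q" using p(2) by blast
    define j where "j = (p - 1) div 2 - p div 3"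
    \<comment> \<open>For p = 6t + 5 exactly t + 1 integers lie strictly between p/3 and
      p/2.\<close>
    have j: "6 * j = p + 1"
    proof -
      obtain t where "p = 6 * t + 5" using p5 by (metis mult_div_mod_eq)
      moreover have "(6 * t + 5) div 3 = 2 * t + 1" by presburger
      ultimately show ?thesis by (simp add: j_def)
    qed
    have p0: "p > 0" using prime_gt_0_nat p(1) by blast
    have "?M = q * j"
    proof (rule max_independent_size_eqI)
      assume "q * j > 0"
      then show "\<exists>A. t_independent (integer_mod_group n) 3 A \<and> card A = q * j"
        using t_independent_3_middle_sixth[OF q p0] by (simp add: j_def)
    next
      fix A assume "t_independent (integer_mod_group n) 3 A"
      then consider "6 * card A \<le> n"
        | m where "m dvd n" "m mod 6 = 5" "6 * m * card A \<le> (m + 1) * n"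
        using t_independent_3_card_le_odd 2(1) by blast
      then have "6 * card A \<le> q * (p + 1)"
      proof cases
        case 1
        then show ?thesis by (simp add: q algebra_simps)
      next
        case (2 m)
        \<comment> \<open>By minimality p \<le> r \<le> m, so 1 + 1/m \<le> 1 + 1/p: the weakest
          bound occurs at m = p. The comparison below is cleared of denominators by the factor
          mp.\<close>
        obtain r where r: "prime r" "r dvd m" "[r = 5] (mod 6)" using prime_factor_5_mod_6 2(2) by blast
        have "?P r" using r 2(1) dvd_trans by blast
        then have "p \<le> r" unfolding p_def by (rule Least_le)
        moreover have m0: "m > 0" using 2(2) by (cases m) auto
        then have "r \<le> m" using r(2) by (rule dvd_imp_le[rotated])
        ultimately have "p \<le> m" by simp
        have "m * p * (6 * card A) = p * (6 * m * card A)" by simp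
        also have "\<dots> \<le> p * ((m + 1) * n)" using 2(3) by (rule mult_le_mono2)
        also have "\<dots> = p * q * (p * m + p)" by (simp add: q algebra_simps)
        also have "\<dots> \<le> p * q * (p * m + m)" using \<open>p \<le> m\<close> by (intro mult_le_mono2) simp
        also have "\<dots> = m * p * (q * (p + 1))" by (simp add: algebra_simps)
        finally show ?thesis using m0 p0 by simp
      qed
      also have "\<dots> = 6 * (q * j)" by (simp only: j[symmetric] mult.left_commute)
      finally show "card A \<le> q * j" by simp
    qed
    moreover have "real j = (real p + 1) / 6" using arg_cong[OF j, of real] by simp
    then have "real (q * j) = real q * ((real p + 1) / 6)" by simp
    then have "real (q * j) = (1 + 1 / real p) * (real n / 6)"
      unfolding q using p0 by (simp add: field_simps)
    ultimately show ?thesis using 2 by (simp add: p_def[symmetric] Let_def)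
  next
    case 3
    \<comment> \<open>This leaves n congruent to 1 or 3 modulo 6, where the construction with m = n
      and q = 1 has exactly \<open>n div 6\<close> elements. It also rules out every exceptional
      divisor m in the upper bound, since m would have a prime factor congruent to 5.\<close>
    have n5: "n mod 6 \<noteq> 5" using 3(2) prime_factor_5_mod_6 by blast
    have val: "(n - 1) div 2 - n div 3 = n div 6"
    proof -
      have "n mod 6 = 1 \<or> n mod 6 = 3" using 3(1) n5 by presburger
      then obtain t where "n = 6 * t + 1 \<or> n = 6 * t + 3" by (metis mult_div_mod_eq)
      moreover have "(6 * t + 1) div 3 = 2 * t" "(6 * t + 3) div 3 = 2 * t + 1"
        "(6 * t + 1) div 6 = t" "(6 * t + 3) div 6 = t"
        by presburger+
      ultimately show ?thesis by auto
    qed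
    have "?M = n div 6"
    proof (rule max_independent_size_eqI)
      assume "n div 6 > 0"
      then show "\<exists>A. t_independent (integer_mod_group n) 3 A \<and> card A = n div 6"
        using t_independent_3_middle_sixth[of n n 1] n unfolding mult_1 mult_1_right val by blast
    next
      fix A assume "t_independent (integer_mod_group n) 3 A"
      then have "6 * card A \<le> n"
        using t_independent_3_card_le_odd[OF 3(1)] prime_factor_5_mod_6 3(2) by (meson dvd_trans)
      then show "card A \<le> n div 6" by simp
    qed
    then show ?thesis
      unfolding if_not_P[OF 3(1)] if_not_P[OF 3(2)] using floor[of 6] by simp
  qed
qed

end
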